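(* Let $p$ be a prime and let $A : \mathbb{Z}_{\geq 0} \to \mathbb{Z}$ be a sequence with $A(0) = 1$. Then $A(n)$ satisfies the Lucas congruences modulo $p$ if and only if the values $A(n)$ modulo $p$ can be encoded by a linear $p$-scheme with a single state.
   Context: Let $p$ be a prime. A sequence $A(n)$ satisfies the Lucas congruences modulo $p$ if, for all $n \in \mathbb{Z}_{\geq 0}$, $A(n) \equiv A(n_0) A(n_1) \cdots A(n_r) \pmod{p}$, where $n = n_0 + n_1 p + \cdots + n_r p^r$ is the expansion of $n$ in base $p$ (for $n = 0$ the right-hand side is the empty product, so that the condition reads $A(0) \equiv 1$). Given a sequence $A : \mathbb{Z}_{\geq 0} \to \mathbb{Z}$, a linear $p$-scheme for $A(n) \pmod{p}$ consists of states $A_0, A_1, \ldots, A_m : \mathbb{Z}_{\geq 0} \to \mathbb{Z}$ with $A_0(n) = A(n)$ such that, for all $i \in \{0, 1, \ldots, m\}$, $k \in \{0, 1, \ldots, p-1\}$ and $n \geq 0$, $$A_i(pn + k) \equiv \sum_{j=0}^m \alpha_{i,j}^{(k)} A_j(n) \pmod{p}$$ for some integers $\alpha_{i,j}^{(k)}$ (independent of $n$). Such a scheme has $m+1$ states; "a single state" means $m = 0$. *)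

theory Defs
  imports "HOL-Number_Theory.Cong"
begin

text \<open>Digit lists are least significant digit first. Trailing zeros (leading zeros of the number)
  are excluded, so the expansion is unique for \<open>p \<ge> 2\<close> and that of \<open>0\<close> is \<open>[]\<close>.\<close>

definition is_base_expansion :: "nat \<Rightarrow> nat \<Rightarrow> nat list \<Rightarrow> bool" where
  "is_base_expansion p n ds \<longleftrightarrow>
     (\<forall>d \<in> set ds. d < p) \<and> (ds \<noteq> [] \<longrightarrow> last ds \<noteq> 0) \<and>
     n = (\<Sum>i<length ds. ds ! i * p ^ i)"

definition lucas_congruences :: "nat \<Rightarrow> (nat \<Rightarrow> int) \<Rightarrow> bool" where
  "lucas_congruences p A \<longleftrightarrow>
     (\<forall>n ds. is_base_expansion p n ds \<longrightarrow>
        [A n = (\<Prod>i<length ds. A (ds ! i))] (mod int p))"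

text \<open>The states are \<open>S 0, \<dots>, S m\<close> (hence \<open>m + 1\<close> of them), and \<open>\<alpha> k i j\<close> is the
  coefficient \<open>\<alpha>\<^bsub>i,j\<^esub>\<^bsup>(k)\<^esup>\<close>.\<close>

definition is_linear_scheme ::
    "nat \<Rightarrow> nat \<Rightarrow> (nat \<Rightarrow> int) \<Rightarrow> (nat \<Rightarrow> nat \<Rightarrow> int) \<Rightarrow> (nat \<Rightarrow> nat \<Rightarrow> nat \<Rightarrow> int) \<Rightarrow> bool" where
  "is_linear_scheme p m A S \<alpha> \<longleftrightarrow>
     (\<forall>n. S 0 n = A n) \<and>
     (\<forall>i\<le>m. \<forall>k<p. \<forall>n. [S i (p * n + k) = (\<Sum>j\<le>m. \<alpha> k i j * S j n)] (mod int p))"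

definition has_linear_scheme :: "nat \<Rightarrow> nat \<Rightarrow> (nat \<Rightarrow> int) \<Rightarrow> bool" where
  "has_linear_scheme p m A \<longleftrightarrow> (\<exists>S \<alpha>. is_linear_scheme p m A S \<alpha>)"

end

theory Submission
  imports Defs
begin

text \<open>Both properties amount to the single-step congruence
  \<open>A (p * n + k) \<equiv> A k * A n\<close> for \<open>k < p\<close>. Since passing from \<open>n\<close> to \<open>p * n + k\<close> puts the digit
  \<open>k\<close> in front of the (least significant first) expansion of \<open>n\<close>, iterating the step along the
  digits yields the Lucas product, and comparing the Lucas products of \<open>n\<close> and \<open>p * n + k\<close> yields
  the step (\<open>lucas_congruences_iff_step\<close>). A scheme with one state is a congruence
  \<open>A (p * n + k) \<equiv> \<alpha>\<^sub>k * A n\<close> with unspecified coefficients; evaluating it at \<open>n = 0\<close>, where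
  \<open>A 0 = 1\<close>, forces \<open>\<alpha>\<^sub>k \<equiv> A k\<close> (\<open>has_linear_scheme_single_state_iff_step\<close>).\<close>

lemma is_base_expansion_Nil_iff: "is_base_expansion p n [] \<longleftrightarrow> n = 0"
  by (simp add: is_base_expansion_def)

text \<open>The digit \<open>0\<close> is allowed in front of \<open>ds\<close> only when \<open>ds\<close> is nonempty, because otherwise it
  would be the leading digit of the number.\<close>

lemma is_base_expansion_Cons_iff:
  "is_base_expansion p n (d # ds) \<longleftrightarrow>
     d < p \<and> (ds = [] \<longrightarrow> d \<noteq> 0) \<and> (\<exists>m. is_base_expansion p m ds \<and> n = p * m + d)"
proof -
  have "(\<Sum>i<length (d # ds). (d # ds) ! i * p ^ i)
      = p * (\<Sum>i<length ds. ds ! i * p ^ i) + d"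
    unfolding length_Cons sum.lessThan_Suc_shift
    by (simp add: sum_distrib_left mult.left_commute)
  then show ?thesis
    by (auto simp: is_base_expansion_def simp del: length_Cons)
qed

lemma is_base_expansion_exists:
  assumes "p \<ge> 2"
  shows "\<exists>ds. is_base_expansion p n ds"
proof (induction n rule: less_induct)
  case (less n)
  show ?case
  proof (cases "n = 0")
    case True
    then show ?thesis
      using is_base_expansion_Nil_iff by blast
  next
    case False
    with assms have "n div p < n"
      by simp
    then obtain ds where ds: "is_base_expansion p (n div p) ds"
      using less by blast
    have n: "n = p * (n div p) + n mod p"
      by simp
    have "ds = [] \<longrightarrow> n mod p \<noteq> 0"
      using ds n False by (metis is_base_expansion_Nil_iff mult_0_right add_0)
    with assms ds n have "is_base_expansion p n (n mod p # ds)"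
      unfolding is_base_expansion_Cons_iff by fastforce
    then show ?thesis ..
  qed
qed

lemma prod_nth_Cons:
  fixes A :: "nat \<Rightarrow> int"
  shows "(\<Prod>i<length (d # ds). A ((d # ds) ! i)) = A d * (\<Prod>i<length ds. A (ds ! i))"
  unfolding length_Cons prod.lessThan_Suc_shift by simp

lemma lucas_congruences_iff_step:
  assumes "p \<ge> 2" and "A 0 = 1"
  shows "lucas_congruences p A \<longleftrightarrow> (\<forall>k<p. \<forall>n. [A (p * n + k) = A k * A n] (mod int p))"
proof (intro iffI allI impI)
  fix k n
  assume lucas: "lucas_congruences p A" and "k < p"
  show "[A (p * n + k) = A k * A n] (mod int p)"
  proof (cases "n = 0 \<and> k = 0")
    \<comment> \<open>Putting the digit \<open>0\<close> in front of the empty expansion does not give an expansion,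
      so this case rests on \<open>A 0 = 1\<close> instead.\<close>
    case True
    with assms show ?thesis
      by simp
  next
    case False
    obtain ds where ds: "is_base_expansion p n ds"
      using assms is_base_expansion_exists by blast
    with False \<open>k < p\<close> have "is_base_expansion p (p * n + k) (k # ds)"
      by (auto simp: is_base_expansion_Cons_iff is_base_expansion_Nil_iff)
    with lucas have "[A (p * n + k) = A k * (\<Prod>i<length ds. A (ds ! i))] (mod int p)"
      unfolding lucas_congruences_def prod_nth_Cons[symmetric] by blast
    moreover have "[A k * A n = A k * (\<Prod>i<length ds. A (ds ! i))] (mod int p)"
      using lucas ds cong_scalar_left unfolding lucas_congruences_def by blast
    ultimately show ?thesis
      using cong_sym cong_trans by blast
  qed
next
  assume step: "\<forall>k<p. \<forall>n. [A (p * n + k) = A k * A n] (mod int p)"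
  have "[A n = (\<Prod>i<length ds. A (ds ! i))] (mod int p)" if "is_base_expansion p n ds" for n ds
    using that
  proof (induction ds arbitrary: n)
    case Nil
    with assms show ?case
      by (simp add: is_base_expansion_Nil_iff)
  next
    case (Cons d ds)
    then obtain m where "d < p" and m: "is_base_expansion p m ds" and n: "n = p * m + d"
      unfolding is_base_expansion_Cons_iff by blast
    have "[A n = A d * A m] (mod int p)"
      using step \<open>d < p\<close> n by blast
    also have "[A d * A m = A d * (\<Prod>i<length ds. A (ds ! i))] (mod int p)"
      using Cons.IH[OF m] by (rule cong_scalar_left)
    finally show ?case
      unfolding prod_nth_Cons .
  qed
  then show "lucas_congruences p A"
    unfolding lucas_congruences_def by blast
qed

lemma has_linear_scheme_single_state_iff_step:
  assumes "A 0 = 1"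
  shows "has_linear_scheme p 0 A \<longleftrightarrow> (\<forall>k<p. \<forall>n. [A (p * n + k) = A k * A n] (mod int p))"
proof
  assume "has_linear_scheme p 0 A"
  then obtain S \<alpha> where scheme: "is_linear_scheme p 0 A S \<alpha>"
    unfolding has_linear_scheme_def by blast
  have step: "[A (p * n + k) = \<alpha> k 0 0 * A n] (mod int p)" if "k < p" for k n
  proof -
    have "S 0 = A"
      using scheme by (auto simp: is_linear_scheme_def)
    with scheme that show ?thesis
      by (simp add: is_linear_scheme_def)
  qed
  show "\<forall>k<p. \<forall>n. [A (p * n + k) = A k * A n] (mod int p)"
  proof (intro allI impI)
    fix k n
    assume "k < p"
    have "[\<alpha> k 0 0 = A k] (mod int p)"
      using step[OF \<open>k < p\<close>, of 0] assms by (simp add: cong_sym)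
    then have "[\<alpha> k 0 0 * A n = A k * A n] (mod int p)"
      by (rule cong_scalar_right)
    with step[OF \<open>k < p\<close>] show "[A (p * n + k) = A k * A n] (mod int p)"
      by (rule cong_trans)
  qed
next
  assume "\<forall>k<p. \<forall>n. [A (p * n + k) = A k * A n] (mod int p)"
  then have "is_linear_scheme p 0 A (\<lambda>_. A) (\<lambda>k _ _. A k)"
    by (simp add: is_linear_scheme_def)
  then show "has_linear_scheme p 0 A"
    unfolding has_linear_scheme_def by blast
qed

theorem proposition1p3:
  fixes p :: nat and A :: "nat \<Rightarrow> int"
  assumes "prime p" and "A 0 = 1"
  shows "lucas_congruences p A \<longleftrightarrow> has_linear_scheme p 0 A"
proof -
  have "p \<ge> 2"
    using assms(1) by (rule prime_ge_2_nat)
  then show ?thesis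
    using assms(2) lucas_congruences_iff_step has_linear_scheme_single_state_iff_step by simp
qed

end
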